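(* Let $I\subset\mathbb{R}$ be an open interval, let $A$ be an asymmetric fuzzy number with $a_m=0.5(\underline{a}_1+\overline{a}_1)$, where $[A]_1=[\underline a_1,\overline a_1]$, and let $f:I\to\mathbb{R}_{\mathcal{F}(A)}$ be a function differentiable in $I$ with $f(t)=r(t)+q(t)A$ for all $t\in I$, where $r,q:I\to\mathbb{R}$. If $t^*\in I$ is a local minimizer or a local maximizer of $f$, then $r'(t^* )+q'(t^* )a_m=0$.
   Context: A fuzzy subset of $\mathbb{R}$ is a function $A:\mathbb{R}\to[0,1]$; its $\alpha$-levels are $[A]_\alpha=\{x: A(x)\geq\alpha\}$ for $0<\alpha\leq1$ and $[A]_0=\overline{\{x:A(x)>0\}}$. $A$ is a fuzzy number if all its $\alpha$-levels are nonempty closed intervals $[\underline a_\alpha,\overline a_\alpha]$ and $\{x:A(x)>0\}$ is bounded. For $r,q\in\mathbb{R}$, $r+qA$ is the fuzzy number with $[r+qA]_\alpha=\{r+qx: x\in[A]_\alpha\}$ for every $\alpha\in[0,1]$. $A$ is asymmetric if for every $x\in\mathbb{R}$ there exists $y\in\mathbb{R}$ with $A(x-y)\neq A(x+y)$. Put $\mathbb{R}_{\mathcal{F}(A)}=\{r+qA: r,q\in\mathbb{R}\}$. When $A$ is asymmetric, $(r,q)\mapsto r+qA$ is a bijection from $\mathbb{R}^2$ onto $\mathbb{R}_{\mathcal{F}(A)}$, and $\mathbb{R}_{\mathcal{F}(A)}$ is a 2-dimensional real vector space with $(r_B+q_BA)\oplus(r_C+q_CA)=(r_B+r_C)+(q_B+q_C)A$,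 $\lambda(r+qA)=\lambda r+(\lambda q)A$ and $B\ominus C=B\oplus(-1)C$, normed by $\|r+qA\|=|q|+|r+qa_m|$. Order: for $B=r_B+q_BA$, $C=r_C+q_CA$, $B\leq C$ if and only if (I) $r_B+q_Ba_m<r_C+q_Ca_m$; or (II) $r_B+q_Ba_m=r_C+q_Ca_m$ and $|q_B|<|q_C|$; or (III) $r_B+q_Ba_m=r_C+q_Ca_m$, $|q_B|=|q_C|$ and $q_B\leq q_C$. $f$ is differentiable at $t$ if $f'(t)=\lim_{h\to0}\frac{f(t+h)\ominus f(t)}{h}$ exists in $\mathbb{R}_{\mathcal{F}(A)}$; equivalently, $r$ and $q$ are differentiable at $t$, and then $f'(t)=r'(t)+q'(t)A$. A point $t^*\in I$ is a local minimizer (maximizer) of $f$ if $f(t^* )\leq f(z)$ ($f(z)\leq f(t^* )$) for all $z$ in a neighborhood of $t^*$ in $I$. *)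

theory Defs
  imports "HOL-Analysis.Analysis"
begin

definition fuzzy_level :: "(real \<Rightarrow> real) \<Rightarrow> real \<Rightarrow> real set" where
  "fuzzy_level A \<alpha> = (if \<alpha> = 0 then closure {x. A x > 0} else {x. A x \<ge> \<alpha>})"

definition fuzzy_number :: "(real \<Rightarrow> real) \<Rightarrow> bool" where
  "fuzzy_number A \<longleftrightarrow>
     (\<forall>x. 0 \<le> A x \<and> A x \<le> 1) \<and>
     (\<forall>\<alpha>\<in>{0..1}. \<exists>a b. a \<le> b \<and> fuzzy_level A \<alpha> = {a..b}) \<and>
     bounded {x. A x > 0}"

definition fuzzy_asymmetric :: "(real \<Rightarrow> real) \<Rightarrow> bool" where
  "fuzzy_asymmetric A \<longleftrightarrow> (\<forall>x. \<exists>y. A (x - y) \<noteq> A (x + y))"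

text \<open>For a fuzzy number \<open>A\<close> the level at \<open>\<alpha>\<close> is a nonempty compact interval, whose endpoints
  are its infimum and supremum.\<close>

definition lower_end :: "(real \<Rightarrow> real) \<Rightarrow> real \<Rightarrow> real" where
  "lower_end A \<alpha> = Inf (fuzzy_level A \<alpha>)"

definition upper_end :: "(real \<Rightarrow> real) \<Rightarrow> real \<Rightarrow> real" where
  "upper_end A \<alpha> = Sup (fuzzy_level A \<alpha>)"

definition core_mid :: "(real \<Rightarrow> real) \<Rightarrow> real" where
  "core_mid A = (lower_end A 1 + upper_end A 1) / 2"

text \<open>The fuzzy number \<open>r + qA\<close>, determined by its levels; see \<open>fuzzy_affine_number\<close> and
  \<open>fuzzy_affine_level\<close> below for well-definedness.\<close>

definition fuzzy_affine :: "real \<Rightarrow> real \<Rightarrow> (real \<Rightarrow> real) \<Rightarrow> (real \<Rightarrow> real)" where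
  "fuzzy_affine r q A =
     (THE B. fuzzy_number B \<and>
             (\<forall>\<alpha>\<in>{0..1}. fuzzy_level B \<alpha> = (\<lambda>x. r + q * x) ` fuzzy_level A \<alpha>))"

definition fuzzy_plane :: "(real \<Rightarrow> real) \<Rightarrow> (real \<Rightarrow> real) set" where
  "fuzzy_plane A = {fuzzy_affine r q A |r q. True}"

text \<open>The coordinates of \<open>B = r + qA\<close>; they are unique when \<open>A\<close> is asymmetric
  (\<open>fuzzy_affine_inject\<close> below), and are only meant for \<open>B\<close> in the plane of such an \<open>A\<close>.\<close>

definition fuzzy_coords :: "(real \<Rightarrow> real) \<Rightarrow> (real \<Rightarrow> real) \<Rightarrow> real \<times> real" where
  "fuzzy_coords A B = (THE p. B = fuzzy_affine (fst p) (snd p) A)"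

definition r_coord :: "(real \<Rightarrow> real) \<Rightarrow> (real \<Rightarrow> real) \<Rightarrow> real" where
  "r_coord A B = fst (fuzzy_coords A B)"

definition q_coord :: "(real \<Rightarrow> real) \<Rightarrow> (real \<Rightarrow> real) \<Rightarrow> real" where
  "q_coord A B = snd (fuzzy_coords A B)"

definition fuzzy_add :: "(real \<Rightarrow> real) \<Rightarrow> (real \<Rightarrow> real) \<Rightarrow> (real \<Rightarrow> real) \<Rightarrow> (real \<Rightarrow> real)" where
  "fuzzy_add A B C =
     fuzzy_affine (r_coord A B + r_coord A C) (q_coord A B + q_coord A C) A"

definition fuzzy_scale :: "(real \<Rightarrow> real) \<Rightarrow> real \<Rightarrow> (real \<Rightarrow> real) \<Rightarrow> (real \<Rightarrow> real)" where
  "fuzzy_scale A c B = fuzzy_affine (c * r_coord A B) (c * q_coord A B) A"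

definition fuzzy_diff :: "(real \<Rightarrow> real) \<Rightarrow> (real \<Rightarrow> real) \<Rightarrow> (real \<Rightarrow> real) \<Rightarrow> (real \<Rightarrow> real)" where
  "fuzzy_diff A B C = fuzzy_add A B (fuzzy_scale A (-1) C)"

definition fuzzy_norm :: "(real \<Rightarrow> real) \<Rightarrow> (real \<Rightarrow> real) \<Rightarrow> real" where
  "fuzzy_norm A B = \<bar>q_coord A B\<bar> + \<bar>r_coord A B + q_coord A B * core_mid A\<bar>"

definition fuzzy_dist :: "(real \<Rightarrow> real) \<Rightarrow> (real \<Rightarrow> real) \<Rightarrow> (real \<Rightarrow> real) \<Rightarrow> real" where
  "fuzzy_dist A B C = fuzzy_norm A (fuzzy_diff A B C)"

definition fuzzy_le :: "(real \<Rightarrow> real) \<Rightarrow> (real \<Rightarrow> real) \<Rightarrow> (real \<Rightarrow> real) \<Rightarrow> bool" where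
  "fuzzy_le A B C \<longleftrightarrow>
     r_coord A B + q_coord A B * core_mid A < r_coord A C + q_coord A C * core_mid A \<or>
     r_coord A B + q_coord A B * core_mid A = r_coord A C + q_coord A C * core_mid A \<and>
       \<bar>q_coord A B\<bar> < \<bar>q_coord A C\<bar> \<or>
     r_coord A B + q_coord A B * core_mid A = r_coord A C + q_coord A C * core_mid A \<and>
       \<bar>q_coord A B\<bar> = \<bar>q_coord A C\<bar> \<and> q_coord A B \<le> q_coord A C"

text \<open>The limit is taken in the metric space \<open>fuzzy_plane A\<close> (see \<open>Metric_space_fuzzy_plane\<close>
  below), so membership of the limit in that space is part of \<^const>\<open>limitin\<close>.\<close>

definition fuzzy_has_derivative ::
    "(real \<Rightarrow> real) \<Rightarrow> (real \<Rightarrow> real \<Rightarrow> real) \<Rightarrow> (real \<Rightarrow> real) \<Rightarrow> real \<Rightarrow> bool" where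
  "fuzzy_has_derivative A f D t \<longleftrightarrow>
     limitin (Metric_space.mtopology (fuzzy_plane A) (fuzzy_dist A))
       (\<lambda>h. fuzzy_scale A (1 / h) (fuzzy_diff A (f (t + h)) (f t))) D (at 0)"

definition fuzzy_differentiable ::
    "(real \<Rightarrow> real) \<Rightarrow> (real \<Rightarrow> real \<Rightarrow> real) \<Rightarrow> real \<Rightarrow> bool" where
  "fuzzy_differentiable A f t \<longleftrightarrow> (\<exists>D. fuzzy_has_derivative A f D t)"

definition fuzzy_local_minimizer ::
    "(real \<Rightarrow> real) \<Rightarrow> real set \<Rightarrow> (real \<Rightarrow> real \<Rightarrow> real) \<Rightarrow> real \<Rightarrow> bool" where
  "fuzzy_local_minimizer A I f t \<longleftrightarrow>
     t \<in> I \<and> (\<exists>U. open U \<and> t \<in> U \<and> (\<forall>z\<in>U \<inter> I. fuzzy_le A (f t) (f z)))"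

definition fuzzy_local_maximizer ::
    "(real \<Rightarrow> real) \<Rightarrow> real set \<Rightarrow> (real \<Rightarrow> real \<Rightarrow> real) \<Rightarrow> real \<Rightarrow> bool" where
  "fuzzy_local_maximizer A I f t \<longleftrightarrow>
     t \<in> I \<and> (\<exists>U. open U \<and> t \<in> U \<and> (\<forall>z\<in>U \<inter> I. fuzzy_le A (f z) (f t)))"


subsection \<open>Well-definedness\<close>

lemma fuzzy_number_eqI:
  assumes B: "fuzzy_number B" and C: "fuzzy_number C"
    and eq: "\<And>\<alpha>. 0 < \<alpha> \<Longrightarrow> \<alpha> \<le> 1 \<Longrightarrow> fuzzy_level B \<alpha> = fuzzy_level C \<alpha>"
  shows "B = C"
proof
  fix x
  have *: "\<And>\<alpha>. 0 < \<alpha> \<Longrightarrow> \<alpha> \<le> 1 \<Longrightarrow> \<alpha> \<le> B x \<longleftrightarrow> \<alpha> \<le> C x"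
    using eq by (fastforce simp: fuzzy_level_def)
  have "0 \<le> B x" "B x \<le> 1" "0 \<le> C x" "C x \<le> 1"
    using B C by (auto simp: fuzzy_number_def)
  then show "B x = C x"
    using *[of "B x"] *[of "C x"] by linarith
qed

lemma ex_fuzzy_affine:
  assumes A: "fuzzy_number A"
  shows "\<exists>B. fuzzy_number B \<and>
             (\<forall>\<alpha>\<in>{0..1}. fuzzy_level B \<alpha> = (\<lambda>x. r + q * x) ` fuzzy_level A \<alpha>)"
proof -
  have ivl: "\<exists>a b. a \<le> b \<and> (\<lambda>x. r + q * x) ` fuzzy_level A \<alpha> = {a..b}"
    if "\<alpha> \<in> {0..1}" for \<alpha>
  proof -
    obtain a b where "a \<le> b" and ab: "fuzzy_level A \<alpha> = {a..b}"
      using A \<open>\<alpha> \<in> {0..1}\<close> unfolding fuzzy_number_def by blast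
    have "(\<lambda>x. r + q * x) ` {a..b} =
        (if 0 \<le> q then {q * a + r..q * b + r} else {q * b + r..q * a + r})"
      using \<open>a \<le> b\<close> image_affinity_atLeastAtMost[of q r a b] by (simp add: add.commute[of r])
    then show ?thesis
      using \<open>a \<le> b\<close> unfolding ab
      by (cases "0 \<le> q") (auto simp: mult_left_mono mult_left_mono_neg intro!: exI)
  qed
  define B where "B = (if q = 0 then indicator {r} else (\<lambda>x. A ((x - r) / q)))"
  have lev: "fuzzy_level B \<alpha> = (\<lambda>x. r + q * x) ` fuzzy_level A \<alpha>" if \<alpha>: "\<alpha> \<in> {0..1}" for \<alpha>
  proof (cases "q = 0")
    case True
    have "fuzzy_level A \<alpha> \<noteq> {}"
      using A \<alpha> by (fastforce simp: fuzzy_number_def)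
    moreover have "fuzzy_level B \<alpha> = {r}"
    proof (cases "\<alpha> = 0")
      case z: True
      have "{x. B x > 0} = {r}"
        using True by (auto simp: B_def indicator_def)
      then show ?thesis
        using z by (simp add: fuzzy_level_def)
    next
      case False
      then show ?thesis
        using True \<alpha> by (auto simp: B_def indicator_def fuzzy_level_def split: if_splits)
    qed
    ultimately show ?thesis
      using True by auto
  next
    case False
    have img: "{x. P (B x)} = (\<lambda>x. r + q * x) ` {x. P (A x)}" for P
    proof (intro set_eqI iffI)
      fix x assume "x \<in> {x. P (B x)}"
      then have "P (A ((x - r) / q))" "x = r + q * ((x - r) / q)"
        using False by (auto simp: B_def)
      then show "x \<in> (\<lambda>x. r + q * x) ` {x. P (A x)}"
        by blast
    qed (use False in \<open>auto simp: B_def\<close>)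
    have clo: "closure ((\<lambda>x. r + q * x) ` S) = (\<lambda>x. r + q * x) ` closure S" for S :: "real set"
    proof -
      have "(\<lambda>x. r + q * x) ` T = (+) r ` ((*\<^sub>R) q ` T)" for T :: "real set"
        by (auto simp: image_image)
      then show ?thesis
        by (simp only: closure_translation closure_scaleR)
    qed
    show ?thesis
      using img[of "\<lambda>y. y \<ge> \<alpha>"] img[of "\<lambda>y. y > 0"] clo[of "{x. A x > 0}"]
      by (simp add: fuzzy_level_def)
  qed
  have "bounded (fuzzy_level B 0)"
    using lev[of 0] ivl[of 0] by auto
  then have "bounded {x. B x > 0}"
    by (simp add: fuzzy_level_def bounded_subset[OF _ closure_subset])
  moreover have "\<forall>x. 0 \<le> B x \<and> B x \<le> 1"
    using A by (auto simp: B_def fuzzy_number_def indicator_def)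
  ultimately have "fuzzy_number B"
    using lev ivl by (simp add: fuzzy_number_def)
  then show ?thesis
    using lev by blast
qed

lemma fuzzy_affine_spec:
  assumes "fuzzy_number A"
  shows "fuzzy_number (fuzzy_affine r q A) \<and>
         (\<forall>\<alpha>\<in>{0..1}. fuzzy_level (fuzzy_affine r q A) \<alpha> = (\<lambda>x. r + q * x) ` fuzzy_level A \<alpha>)"
proof -
  have "\<exists>!B. fuzzy_number B \<and>
          (\<forall>\<alpha>\<in>{0..1}. fuzzy_level B \<alpha> = (\<lambda>x. r + q * x) ` fuzzy_level A \<alpha>)"
    using ex_fuzzy_affine[OF assms, of r q] by (auto intro!: fuzzy_number_eqI)
  from theI'[OF this] show ?thesis
    unfolding fuzzy_affine_def .
qed

lemma fuzzy_affine_number: "fuzzy_number A \<Longrightarrow> fuzzy_number (fuzzy_affine r q A)"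
  using fuzzy_affine_spec by blast

lemma fuzzy_affine_level:
  "fuzzy_number A \<Longrightarrow> \<alpha> \<in> {0..1} \<Longrightarrow>
     fuzzy_level (fuzzy_affine r q A) \<alpha> = (\<lambda>x. r + q * x) ` fuzzy_level A \<alpha>"
  using fuzzy_affine_spec by blast

lemma fuzzy_level_ends:
  assumes "fuzzy_number A" "\<alpha> \<in> {0..1}"
  shows "lower_end A \<alpha> \<le> upper_end A \<alpha>" "fuzzy_level A \<alpha> = {lower_end A \<alpha>..upper_end A \<alpha>}"
proof -
  obtain a b where "a \<le> b" "fuzzy_level A \<alpha> = {a..b}"
    using assms unfolding fuzzy_number_def by blast
  then show "lower_end A \<alpha> \<le> upper_end A \<alpha>" "fuzzy_level A \<alpha> = {lower_end A \<alpha>..upper_end A \<alpha>}"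
    by (auto simp: lower_end_def upper_end_def)
qed

lemma fuzzy_affine_ends_sum:
  assumes "fuzzy_number A" "\<alpha> \<in> {0..1}"
  shows "lower_end (fuzzy_affine r q A) \<alpha> + upper_end (fuzzy_affine r q A) \<alpha> =
           2 * r + q * (lower_end A \<alpha> + upper_end A \<alpha>)"
proof -
  define a b where "a = lower_end A \<alpha>" and "b = upper_end A \<alpha>"
  have ab: "a \<le> b" "fuzzy_level A \<alpha> = {a..b}"
    using fuzzy_level_ends[OF assms] by (auto simp: a_def b_def)
  have "fuzzy_level (fuzzy_affine r q A) \<alpha> =
      (if 0 \<le> q then {q * a + r..q * b + r} else {q * b + r..q * a + r})"
    using fuzzy_affine_level[OF assms, of r q] ab image_affinity_atLeastAtMost[of q r a b]
    by (simp add: add.commute[of r])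
  moreover have "0 \<le> q \<Longrightarrow> q * a \<le> q * b" "q \<le> 0 \<Longrightarrow> q * b \<le> q * a"
    using ab by (auto intro: mult_left_mono mult_left_mono_neg)
  ultimately show ?thesis
    unfolding lower_end_def[of "fuzzy_affine r q A"] upper_end_def[of "fuzzy_affine r q A"]
    by (cases "0 \<le> q") (auto simp: a_def[symmetric] b_def[symmetric] algebra_simps)
qed

lemma fuzzy_affine_inject:
  assumes A: "fuzzy_number A" and asym: "fuzzy_asymmetric A"
  shows "fuzzy_affine r q A = fuzzy_affine r' q' A \<longleftrightarrow> r = r' \<and> q = q'"
proof
  assume eq: "fuzzy_affine r q A = fuzzy_affine r' q' A"
  define m where "m \<alpha> = lower_end A \<alpha> + upper_end A \<alpha>" for \<alpha>
  have m: "2 * r + q * m \<alpha> = 2 * r' + q' * m \<alpha>" if "\<alpha> \<in> {0..1}" for \<alpha>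
    using fuzzy_affine_ends_sum[OF A that, of r q] fuzzy_affine_ends_sum[OF A that, of r' q'] eq
    by (simp add: m_def)
  have "q = q'"
  proof (rule ccontr)
    assume "q \<noteq> q'"
    define c where "c = (r' - r) / (q - q')"
    have mc: "m \<alpha> = 2 * c" if "\<alpha> \<in> {0..1}" for \<alpha>
      using m[OF that] \<open>q \<noteq> q'\<close> by (simp add: c_def field_simps)
    have sym: "\<alpha> \<le> A (c - y) \<longleftrightarrow> \<alpha> \<le> A (c + y)" if "0 < \<alpha>" "\<alpha> \<le> 1" for \<alpha> y
    proof -
      have \<alpha>: "\<alpha> \<in> {0..1}"
        using that by simp
      have "z \<in> fuzzy_level A \<alpha> \<longleftrightarrow> \<alpha> \<le> A z" for z
        using that by (simp add: fuzzy_level_def)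
      then have lev: "\<alpha> \<le> A z \<longleftrightarrow> lower_end A \<alpha> \<le> z \<and> z \<le> upper_end A \<alpha>" for z
        by (metis fuzzy_level_ends(2)[OF A \<alpha>] atLeastAtMost_iff)
      have "lower_end A \<alpha> = 2 * c - upper_end A \<alpha>"
        using mc[OF \<alpha>] by (simp add: m_def)
      then show ?thesis
        unfolding lev[of "c - y"] lev[of "c + y"] by auto
    qed
    have "A (c - y) = A (c + y)" for y
    proof -
      have "0 \<le> A (c - y)" "A (c - y) \<le> 1" "0 \<le> A (c + y)" "A (c + y) \<le> 1"
        using A by (auto simp: fuzzy_number_def)
      then show ?thesis
        using sym[of "A (c - y)" y] sym[of "A (c + y)" y] by linarith
    qed
    then show False
      using asym by (auto simp: fuzzy_asymmetric_def)
  qed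
  then show "r = r' \<and> q = q'"
    using m[of 1] by simp
qed simp

lemma coords_fuzzy_affine [simp]:
  assumes "fuzzy_number A" "fuzzy_asymmetric A"
  shows "r_coord A (fuzzy_affine r q A) = r" "q_coord A (fuzzy_affine r q A) = q"
proof -
  have "fuzzy_coords A (fuzzy_affine r q A) = (r, q)"
    unfolding fuzzy_coords_def using assms
    by (intro the_equality) (auto simp: fuzzy_affine_inject)
  then show "r_coord A (fuzzy_affine r q A) = r" "q_coord A (fuzzy_affine r q A) = q"
    by (simp_all add: r_coord_def q_coord_def)
qed

lemma fuzzy_dist_coords:
  assumes "fuzzy_number A" "fuzzy_asymmetric A"
  shows "fuzzy_dist A B C = \<bar>q_coord A B - q_coord A C\<bar> +
    \<bar>(r_coord A B + q_coord A B * core_mid A) - (r_coord A C + q_coord A C * core_mid A)\<bar>"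
  using assms
  by (simp add: fuzzy_dist_def fuzzy_norm_def fuzzy_diff_def fuzzy_add_def fuzzy_scale_def
      algebra_simps)

lemma Metric_space_fuzzy_plane:
  assumes "fuzzy_number A" "fuzzy_asymmetric A"
  shows "Metric_space (fuzzy_plane A) (fuzzy_dist A)"
proof
  fix B C assume "B \<in> fuzzy_plane A" "C \<in> fuzzy_plane A"
  then obtain r q r' q' where BC: "B = fuzzy_affine r q A" "C = fuzzy_affine r' q' A"
    by (auto simp: fuzzy_plane_def)
  have "q = q' \<and> r = r'"
    if "\<bar>q - q'\<bar> + \<bar>(r + q * core_mid A) - (r' + q' * core_mid A)\<bar> = 0"
  proof -
    have "q = q'"
      using that by linarith
    with that show ?thesis
      by simp
  qed
  then show "fuzzy_dist A B C = 0 \<longleftrightarrow> B = C"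
    unfolding BC using assms by (auto simp: fuzzy_dist_coords fuzzy_affine_inject)
qed (auto simp: fuzzy_dist_coords[OF assms])

end

theory Submission
  imports Defs
begin

text \<open>
  In the coordinates \<^term>\<open>(r, q)\<close>, call \<^term>\<open>r + q * core_mid A\<close> the centre of
  \<^term>\<open>fuzzy_affine r q A\<close>. The order on the plane is lexicographic and compares centres
  first, so the centre is a monotone real function on the plane, and a local extremum of the fuzzy
  function is a weak local extremum of \<open>s \<mapsto> r s + q s * core_mid A\<close>.

  The norm of the plane is the sum of the absolute values of the \<open>q\<close>-coordinate and of the centre.
  Hence convergence of the fuzzy difference quotients is convergence of the difference quotients of
  these two real functions, both are differentiable (lemma \<open>fuzzy_has_derivative_coords\<close>), and
  Fermat's theorem applied to the centre gives the vanishing of \<open>r' + q' * core_mid A\<close>.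
\<close>

lemma fuzzy_le_imp_centre_le:
  assumes "fuzzy_number A" "fuzzy_asymmetric A"
    and "fuzzy_le A (fuzzy_affine r q A) (fuzzy_affine r' q' A)"
  shows "r + q * core_mid A \<le> r' + q' * core_mid A"
  using assms by (auto simp: fuzzy_le_def)

text \<open>The distance dominates both the difference of the \<open>q\<close>-coordinates and the difference of the
  centres, so a limit in the plane is a limit of each of them; the limit of the \<open>r\<close>-coordinates
  follows because \<open>r\<close> is a linear combination of the centre and \<open>q\<close>.\<close>

lemma limitin_fuzzy_plane_coords:
  assumes A: "fuzzy_number A" "fuzzy_asymmetric A"
    and lim: "limitin (Metric_space.mtopology (fuzzy_plane A) (fuzzy_dist A)) F D net"
  shows "((\<lambda>x. r_coord A (F x)) \<longlongrightarrow> r_coord A D) net"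
    and "((\<lambda>x. q_coord A (F x)) \<longlongrightarrow> q_coord A D) net"
proof -
  let ?m = "core_mid A"
  let ?c = "\<lambda>B. r_coord A B + q_coord A B * ?m"
  interpret Metric_space "fuzzy_plane A" "fuzzy_dist A"
    using A by (rule Metric_space_fuzzy_plane)
  have small: "\<forall>\<^sub>F x in net. fuzzy_dist A (F x) D < e" if "e > 0" for e
    using lim that by (auto simp: limitin_metric elim: eventually_mono)
  show q: "((\<lambda>x. q_coord A (F x)) \<longlongrightarrow> q_coord A D) net"
  proof (rule tendstoI)
    fix e :: real assume "e > 0"
    from small[OF this] show "\<forall>\<^sub>F x in net. dist (q_coord A (F x)) (q_coord A D) < e"
      by eventually_elim (simp add: fuzzy_dist_coords[OF A] dist_real_def)
  qed
  have c: "((\<lambda>x. ?c (F x)) \<longlongrightarrow> ?c D) net"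
  proof (rule tendstoI)
    fix e :: real assume "e > 0"
    from small[OF this] show "\<forall>\<^sub>F x in net. dist (?c (F x)) (?c D) < e"
      by eventually_elim (simp add: fuzzy_dist_coords[OF A] dist_real_def)
  qed
  from tendsto_diff[OF c tendsto_mult_right[OF q, of ?m]]
  show "((\<lambda>x. r_coord A (F x)) \<longlongrightarrow> r_coord A D) net"
    by simp
qed

lemma fuzzy_has_derivative_coords:
  assumes A: "fuzzy_number A" "fuzzy_asymmetric A"
    and I: "open I" "t \<in> I"
    and f: "\<And>s. s \<in> I \<Longrightarrow> f s = fuzzy_affine (r s) (q s) A"
    and D: "fuzzy_has_derivative A f D t"
  shows "(r has_real_derivative r_coord A D) (at t)"
    and "(q has_real_derivative q_coord A D) (at t)"
proof -
  let ?F = "\<lambda>h. fuzzy_scale A (1 / h) (fuzzy_diff A (f (t + h)) (f t))"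
  note lims = limitin_fuzzy_plane_coords[OF A D[unfolded fuzzy_has_derivative_def]]
  \<comment> \<open>The coordinates of \<^term>\<open>f (t + h)\<close> are only known while \<^term>\<open>t + h\<close> stays in \<^term>\<open>I\<close>.\<close>
  have "\<forall>\<^sub>F h in at 0. t + h \<in> I"
  proof -
    have "((\<lambda>h. t + h) \<longlongrightarrow> t) (at 0)"
      by (auto intro!: tendsto_eq_intros)
    then show ?thesis
      using I by (rule topological_tendstoD)
  qed
  then have "\<forall>\<^sub>F h in at 0. r_coord A (?F h) = (r (t + h) - r t) / h"
    and "\<forall>\<^sub>F h in at 0. q_coord A (?F h) = (q (t + h) - q t) / h"
    by (eventually_elim,
        simp add: A f I fuzzy_scale_def fuzzy_diff_def fuzzy_add_def)+
  then show "(r has_real_derivative r_coord A D) (at t)"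
    and "(q has_real_derivative q_coord A D) (at t)"
    unfolding DERIV_def using lims by (auto elim: Lim_transform_eventually)
qed

theorem lemma2:
  fixes A :: "real \<Rightarrow> real" and I :: "real set"
    and f :: "real \<Rightarrow> real \<Rightarrow> real" and r q :: "real \<Rightarrow> real" and t :: real
  assumes "open I" and "is_interval I"
    and "fuzzy_number A" and "fuzzy_asymmetric A"
    and "\<And>s. s \<in> I \<Longrightarrow> f s \<in> fuzzy_plane A"
    and "\<And>s. s \<in> I \<Longrightarrow> fuzzy_differentiable A f s"
    and "\<And>s. s \<in> I \<Longrightarrow> f s = fuzzy_affine (r s) (q s) A"
    and "t \<in> I"
    and "fuzzy_local_minimizer A I f t \<or> fuzzy_local_maximizer A I f t"
  shows "r differentiable (at t) \<and> q differentiable (at t) \<and>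
         deriv r t + deriv q t * core_mid A = 0"
proof -
  let ?c = "\<lambda>s. r s + q s * core_mid A"
  note A = assms(3,4) and f = assms(7)
  obtain D where D: "fuzzy_has_derivative A f D t"
    using assms(6)[OF \<open>t \<in> I\<close>] by (auto simp: fuzzy_differentiable_def)
  note rq = fuzzy_has_derivative_coords[OF A \<open>open I\<close> \<open>t \<in> I\<close> f D]
  have der: "(?c has_real_derivative r_coord A D + q_coord A D * core_mid A) (at t)"
    using rq by (auto intro!: derivative_eq_intros)
  have mono: "?c s \<le> ?c s'" if "s \<in> I" "s' \<in> I" "fuzzy_le A (f s) (f s')" for s s'
    using fuzzy_le_imp_centre_le[OF A] that by (simp add: f)
  have nbhd: "\<exists>d>0. \<forall>s. \<bar>t - s\<bar> < d \<longrightarrow> s \<in> U \<inter> I" if "open U" "t \<in> U" for U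
  proof -
    have "open (U \<inter> I)" "t \<in> U \<inter> I"
      using that \<open>open I\<close> \<open>t \<in> I\<close> by auto
    then obtain d where "d > 0" "ball t d \<subseteq> U \<inter> I"
      by (metis open_contains_ball)
    then show ?thesis
      by (auto simp: ball_def dist_real_def)
  qed
  have "r_coord A D + q_coord A D * core_mid A = 0"
    using assms(9)
  proof
    assume "fuzzy_local_minimizer A I f t"
    then obtain U where U: "open U" "t \<in> U" "\<forall>s\<in>U \<inter> I. fuzzy_le A (f t) (f s)"
      by (auto simp: fuzzy_local_minimizer_def)
    then obtain d where "d > 0" "\<forall>s. \<bar>t - s\<bar> < d \<longrightarrow> s \<in> U \<inter> I"
      using nbhd by blast
    moreover from this U have "\<forall>s. \<bar>t - s\<bar> < d \<longrightarrow> ?c t \<le> ?c s"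
      using mono \<open>t \<in> I\<close> by blast
    ultimately show ?thesis
      using DERIV_local_min[OF der] by blast
  next
    assume "fuzzy_local_maximizer A I f t"
    then obtain U where U: "open U" "t \<in> U" "\<forall>s\<in>U \<inter> I. fuzzy_le A (f s) (f t)"
      by (auto simp: fuzzy_local_maximizer_def)
    then obtain d where "d > 0" "\<forall>s. \<bar>t - s\<bar> < d \<longrightarrow> s \<in> U \<inter> I"
      using nbhd by blast
    moreover from this U have "\<forall>s. \<bar>t - s\<bar> < d \<longrightarrow> ?c s \<le> ?c t"
      using mono \<open>t \<in> I\<close> by blast
    ultimately show ?thesis
      using DERIV_local_max[OF der] by blast
  qed
  moreover have "r differentiable (at t)" "q differentiable (at t)"
    using rq by (auto simp: real_differentiable_def)
  ultimately show ?thesis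
    using rq[THEN DERIV_imp_deriv] by simp
qed

end
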